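(* Let $H$ be a subgroup of $\mathbb{Z}^k$, let $G=\mathbb{Z}^k/H$ and let $f:\mathbb{Z}^k\to G$ be the quotient map. Let $P=f(\mathbb{N}^k)\subseteq G$. Suppose that $\Gamma$ is a row-finite $P$-graph with no sources. Then $f^*\Gamma$ is a row-finite $k$-graph with no sources. Suppose that $h\in H$ and $\lambda\in\Gamma$ satisfy $d(\lambda)=f(h_+)$. Then $(\lambda,h_+)$ and $(\lambda,h_-)$ both belong to $f^*\Gamma$.
   Context: Conventions: $\mathbb{N}$ contains $0$. For $h\in\mathbb{Z}^k$, $h_+:=h\vee0$ and $h_-:=-(h\wedge0)$ (coordinatewise max and min), so $h=h_+-h_-$ with $h_+\wedge h_-=0$. For a finitely generated cancellative abelian monoid $P$ (regarded as a category with one object), a $P$-graph is a countable small category $\Gamma$ (identified with its set of morphisms) with a functor $d:\Gamma\to P$ satisfying the factorisation property: whenever $d(\xi)=p+q$ there exist unique $\eta,\zeta\in\Gamma$ with $d(\eta)=p$, $d(\zeta)=q$ and $\xi=\eta\zeta$. A $k$-graph is an $\mathbb{N}^k$-graph. $\Gamma^p=d^{-1}(p)$; $r,s$ denote codomain and domain; $\Gamma^0$ is the set of identity morphisms, identified with the objects; $v\Gamma^p=\{\xi\in\Gamma^p:r(\xi)=v\}$. $\Gamma$ is row-finite with no sources if $0<|v\Gamma^p|<\infty$ for all $v\in\Gamma^0,p\in P$. Pullback: $f^*\Gamma=\{(\lambda,n)\in\Gamma\times\mathbb{N}^k:d(\lambda)=f(n)\}$ with $d(\lambda,n)=n$, $s(\lambda,n)=s(\lambda)$,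 $r(\lambda,n)=r(\lambda)$ (where $v\in\Gamma^0$ is identified with $(v,0)$), and composition $(\mu,m)(\nu,n)=(\mu\nu,m+n)$. *)

theory Defs
  imports "HOL-Algebra.Algebra" "HOL-Library.Countable_Set"
begin

section \<open>Finitely generated cancellative abelian monoids\<close>

locale fg_cancel_monoid = comm_monoid_cancel P for P (structure) +
  assumes finitely_generated:
    "\<exists>S. finite S \<and> S \<subseteq> carrier P \<and>
         (\<forall>T. submonoid T P \<and> S \<subseteq> T \<longrightarrow> T = carrier P)"

section \<open>Small categories, identified with their sets of morphisms\<close>

text \<open>Objects are identified with their identity morphisms, so source (domain) and range (codomain)
  take values in the morphisms. As in the graph-algebra literature,
  \<open>cmp C x y\<close> is defined when \<open>src C x = rng C y\<close>.\<close>

record 'm precat =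
  mor :: "'m set"
  src :: "'m \<Rightarrow> 'm"
  rng :: "'m \<Rightarrow> 'm"
  cmp :: "'m \<Rightarrow> 'm \<Rightarrow> 'm"

definition identities :: "('m, 'z) precat_scheme \<Rightarrow> 'm set" where
  "identities C = {v \<in> mor C. src C v = v \<and> rng C v = v}"

locale small_category =
  fixes C :: "('m, 'z) precat_scheme"
  assumes src_identity: "x \<in> mor C \<Longrightarrow> src C x \<in> identities C"
    and rng_identity: "x \<in> mor C \<Longrightarrow> rng C x \<in> identities C"
    and cmp_closed: "\<lbrakk>x \<in> mor C; y \<in> mor C; src C x = rng C y\<rbrakk> \<Longrightarrow> cmp C x y \<in> mor C"
    and src_cmp: "\<lbrakk>x \<in> mor C; y \<in> mor C; src C x = rng C y\<rbrakk> \<Longrightarrow> src C (cmp C x y) = src C y"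
    and rng_cmp: "\<lbrakk>x \<in> mor C; y \<in> mor C; src C x = rng C y\<rbrakk> \<Longrightarrow> rng C (cmp C x y) = rng C x"
    and cmp_assoc: "\<lbrakk>x \<in> mor C; y \<in> mor C; z \<in> mor C; src C x = rng C y; src C y = rng C z\<rbrakk>
      \<Longrightarrow> cmp C (cmp C x y) z = cmp C x (cmp C y z)"
    and rng_unit: "x \<in> mor C \<Longrightarrow> cmp C (rng C x) x = x"
    and src_unit: "x \<in> mor C \<Longrightarrow> cmp C x (src C x) = x"

section \<open>\<open>P\<close>-graphs\<close>

record ('m, 'p) graded_precat = "'m precat" +
  deg :: "'m \<Rightarrow> 'p"

locale P_graph = fg_cancel_monoid P + small_category \<Gamma>
  for P :: "('p, 'y) monoid_scheme" (structure) and \<Gamma> :: "('m, 'p) graded_precat" +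
  assumes countable_mor: "countable (mor \<Gamma>)"
    and deg_closed: "x \<in> mor \<Gamma> \<Longrightarrow> deg \<Gamma> x \<in> carrier P"
    and deg_identity: "v \<in> identities \<Gamma> \<Longrightarrow> deg \<Gamma> v = \<one>"
    and deg_cmp: "\<lbrakk>x \<in> mor \<Gamma>; y \<in> mor \<Gamma>; src \<Gamma> x = rng \<Gamma> y\<rbrakk>
      \<Longrightarrow> deg \<Gamma> (cmp \<Gamma> x y) = deg \<Gamma> x \<otimes> deg \<Gamma> y"
    and factorisation: "\<lbrakk>x \<in> mor \<Gamma>; p \<in> carrier P; q \<in> carrier P; deg \<Gamma> x = p \<otimes> q\<rbrakk>
      \<Longrightarrow> \<exists>!(y, z). y \<in> mor \<Gamma> \<and> z \<in> mor \<Gamma> \<and> src \<Gamma> y = rng \<Gamma> z \<and>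
            deg \<Gamma> y = p \<and> deg \<Gamma> z = q \<and> x = cmp \<Gamma> y z"

definition paths_from :: "('m, 'p) graded_precat \<Rightarrow> 'm \<Rightarrow> 'p \<Rightarrow> 'm set" where
  "paths_from \<Gamma> v p = {x \<in> mor \<Gamma>. deg \<Gamma> x = p \<and> rng \<Gamma> x = v}"

definition row_finite_no_sources ::
    "('p, 'y) monoid_scheme \<Rightarrow> ('m, 'p) graded_precat \<Rightarrow> bool" where
  "row_finite_no_sources P \<Gamma> \<longleftrightarrow>
     (\<forall>v \<in> identities \<Gamma>. \<forall>p \<in> carrier P.
        paths_from \<Gamma> v p \<noteq> {} \<and> finite (paths_from \<Gamma> v p))"

section \<open>The monoids \<open>\<int>\<^sup>k\<close> and \<open>\<nat>\<^sup>k\<close>, and \<open>k\<close>-graphs\<close>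

text \<open>Elements of \<open>Zpow k\<close> are extensional functions on \<open>{..<k}\<close>: they are \<open>undefined\<close> at
  indices \<open>i \<ge> k\<close>.\<close>

abbreviation Zpow :: "nat \<Rightarrow> (nat \<Rightarrow> int) monoid" where
  "Zpow k \<equiv> product_group {..<k} (\<lambda>_. integer_group)"

definition Npow :: "nat \<Rightarrow> (nat \<Rightarrow> int) monoid" where
  "Npow k = (Zpow k)\<lparr>carrier := {n \<in> carrier (Zpow k). \<forall>i<k. 0 \<le> n i}\<rparr>"

abbreviation k_graph :: "nat \<Rightarrow> ('m, nat \<Rightarrow> int) graded_precat \<Rightarrow> bool" where
  "k_graph k \<equiv> P_graph (Npow k)"

definition pos_part :: "nat \<Rightarrow> (nat \<Rightarrow> int) \<Rightarrow> (nat \<Rightarrow> int)" where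
  "pos_part k h = (\<lambda>i\<in>{..<k}. max (h i) 0)"

definition neg_part :: "nat \<Rightarrow> (nat \<Rightarrow> int) \<Rightarrow> (nat \<Rightarrow> int)" where
  "neg_part k h = (\<lambda>i\<in>{..<k}. - min (h i) 0)"

section \<open>The quotient map and its image of \<open>\<nat>\<^sup>k\<close>\<close>

definition quotient_map :: "nat \<Rightarrow> (nat \<Rightarrow> int) set \<Rightarrow> (nat \<Rightarrow> int) \<Rightarrow> (nat \<Rightarrow> int) set" where
  "quotient_map k H n = H #>\<^bsub>Zpow k\<^esub> n"

definition quotient_monoid :: "nat \<Rightarrow> (nat \<Rightarrow> int) set \<Rightarrow> (nat \<Rightarrow> int) set monoid" where
  "quotient_monoid k H = (Zpow k Mod H)\<lparr>carrier := quotient_map k H ` carrier (Npow k)\<rparr>"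

section \<open>Pullbacks\<close>

text \<open>A vertex \<open>v\<close> of \<open>\<Gamma>\<close> corresponds to the vertex \<open>(v, 0)\<close> of the pullback, which is why source
  and range have second coordinate \<open>0\<close>.\<close>

definition pullback ::
    "nat \<Rightarrow> ((nat \<Rightarrow> int) \<Rightarrow> 'p) \<Rightarrow> ('m, 'p) graded_precat
      \<Rightarrow> ('m \<times> (nat \<Rightarrow> int), nat \<Rightarrow> int) graded_precat" where
  "pullback k f \<Gamma> =
    \<lparr>mor = {(x, n). x \<in> mor \<Gamma> \<and> n \<in> carrier (Npow k) \<and> deg \<Gamma> x = f n},
     src = (\<lambda>(x, n). (src \<Gamma> x, \<one>\<^bsub>Npow k\<^esub>)),
     rng = (\<lambda>(x, n). (rng \<Gamma> x, \<one>\<^bsub>Npow k\<^esub>)),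
     cmp = (\<lambda>(x, m) (y, n). (cmp \<Gamma> x y, m \<otimes>\<^bsub>Npow k\<^esub> n)),
     deg = snd\<rparr>"

end

theory Submission
  imports Defs
begin

text \<open>A morphism of the pullback is a morphism of \<open>\<Gamma>\<close> together with a chosen lift of its degree to
  \<open>\<nat>\<^sup>k\<close> under the quotient map \<open>f\<close>. Since \<open>f\<close> restricts to a monoid homomorphism on \<open>\<nat>\<^sup>k\<close>, the category structure is inherited
  coordinatewise from \<open>\<Gamma>\<close> and the one-object category \<open>\<nat>\<^sup>k\<close>. For the factorisation property, splitting
  the degree \<open>n\<close> of \<open>(x, n)\<close> as \<open>p + q\<close> splits the degree of \<open>x\<close> as \<open>f p \<otimes> f q\<close>, so factorisations
  of \<open>(x, n)\<close> of type \<open>(p, q)\<close> are exactly those of \<open>x\<close> of type \<open>(f p, f q)\<close>, with second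
  coordinates \<open>p\<close> and \<open>q\<close> attached. In the same way the paths of degree \<open>n\<close> into a vertex \<open>(v, 0)\<close>
  correspond bijectively to the paths of degree \<open>f n\<close> into \<open>v\<close>, which transfers row-finiteness and
  the absence of sources. This argument works for every homomorphism from \<open>\<nat>\<^sup>k\<close> to the grading
  monoid and is carried out at that generality (\<open>k_graph_pullback\<close>,
  \<open>row_finite_no_sources_pullback\<close>).

  The quotient map is such a homomorphism (\<open>quotient_map_hom\<close>). The last claim holds because
  \<open>h\<^sub>+ = h + h\<^sub>-\<close>: for \<open>h \<in> H\<close> the elements \<open>h\<^sub>+\<close> and \<open>h\<^sub>-\<close> lie in the same coset, so a morphism
  whose degree lifts to \<open>h\<^sub>+\<close> also has \<open>h\<^sub>-\<close> as a lift of its degree.\<close>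

section \<open>The monoids \<open>\<int>\<^sup>k\<close> and \<open>\<nat>\<^sup>k\<close>\<close>

lemma comm_group_Zpow: "comm_group (Zpow k)"
proof -
  interpret group "Zpow k" by simp
  show ?thesis
    by (rule group_comm_groupI) (simp add: add.commute)
qed

lemma carrier_Npow: "carrier (Npow k) = {n \<in> extensional {..<k}. \<forall>i<k. 0 \<le> n i}"
  by (auto simp: Npow_def PiE_def)

lemma carrier_Npow_subset: "carrier (Npow k) \<subseteq> carrier (Zpow k)"
  by (auto simp: Npow_def)

lemma mult_Npow: "m \<otimes>\<^bsub>Npow k\<^esub> n = (\<lambda>i\<in>{..<k}. m i + n i)"
  by (simp add: Npow_def)

lemma one_Npow: "\<one>\<^bsub>Npow k\<^esub> = (\<lambda>i\<in>{..<k}. 0)"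
  by (simp add: Npow_def)

lemma comm_monoid_cancel_Npow: "comm_monoid_cancel (Npow k)"
proof (rule comm_monoid_cancelI)
  have "submonoid (carrier (Npow k)) (Zpow k)"
    by unfold_locales (auto simp: carrier_Npow mult_Npow one_Npow Npow_def PiE_def)
  then have "comm_monoid ((Zpow k)\<lparr>carrier := carrier (Npow k)\<rparr>)"
    using comm_monoid.submonoid_is_comm_monoid comm_group_Zpow comm_group.axioms(1) by blast
  then show "comm_monoid (Npow k)"
    by (simp add: Npow_def)
next
  fix a b c
  assume eq: "a \<otimes>\<^bsub>Npow k\<^esub> c = b \<otimes>\<^bsub>Npow k\<^esub> c"
    and carriers: "a \<in> carrier (Npow k)" "b \<in> carrier (Npow k)"
  show "a = b"
  proof (rule extensionalityI)
    show "a \<in> extensional {..<k}" "b \<in> extensional {..<k}"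
      using carriers by (simp_all add: carrier_Npow)
    show "a i = b i" if "i \<in> {..<k}" for i
      using fun_cong[OF eq, of i] that by (simp add: mult_Npow)
  qed
qed

definition unit_vector :: "nat \<Rightarrow> nat \<Rightarrow> (nat \<Rightarrow> int)" where
  "unit_vector k j = (\<lambda>i\<in>{..<k}. if i = j then 1 else 0)"

text \<open>Induction on the sum of the coordinates: as long as some coordinate is positive, a unit vector
  can be split off.\<close>

lemma submonoid_Npow_eq_carrier:
  assumes T: "submonoid T (Npow k)" and units: "unit_vector k ` {..<k} \<subseteq> T"
  shows "T = carrier (Npow k)"
proof
  interpret T: submonoid T "Npow k" by (rule T)
  show "T \<subseteq> carrier (Npow k)"
    by (rule T.subset)
  have in_T: "n \<in> T" if "n \<in> carrier (Npow k)" "(\<Sum>i<k. nat (n i)) = s" for n s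
    using that
  proof (induction s arbitrary: n)
    case 0
    then have "n = \<one>\<^bsub>Npow k\<^esub>"
      by (intro extensionalityI[where A = "{..<k}"]) (auto simp: carrier_Npow one_Npow)
    then show ?case by simp
  next
    case (Suc s)
    then obtain j where j: "j < k" "0 < nat (n j)"
      by (metis lessThan_iff not_gr_zero sum.neutral nat.distinct(1))
    define m where "m = n(j := n j - 1)"
    have m: "m \<in> carrier (Npow k)"
      using Suc.prems(1) j by (auto simp: carrier_Npow m_def extensional_def)
    have "(\<Sum>i<k. nat (n i)) = nat (n j) + (\<Sum>i\<in>{..<k} - {j}. nat (n i))"
      "(\<Sum>i<k. nat (m i)) = nat (m j) + (\<Sum>i\<in>{..<k} - {j}. nat (m i))"
      using j by (auto intro: sum.remove)
    moreover have "(\<Sum>i\<in>{..<k} - {j}. nat (m i)) = (\<Sum>i\<in>{..<k} - {j}. nat (n i))"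
      by (rule sum.cong) (auto simp: m_def)
    moreover have "nat (n j) = Suc (nat (m j))"
      using j by (simp add: m_def)
    ultimately have "(\<Sum>i<k. nat (m i)) = s"
      using Suc.prems(2) by simp
    with m have "m \<in> T"
      by (rule Suc.IH)
    moreover have "unit_vector k j \<in> T"
      using units j by auto
    moreover have "n = m \<otimes>\<^bsub>Npow k\<^esub> unit_vector k j"
      using Suc.prems(1)
      by (intro extensionalityI[where A = "{..<k}"])
        (auto simp: carrier_Npow mult_Npow unit_vector_def m_def)
    ultimately show ?case by simp
  qed
  show "carrier (Npow k) \<subseteq> T"
    by (rule subsetI) (rule in_T[OF _ refl])
qed

lemma fg_cancel_monoid_Npow: "fg_cancel_monoid (Npow k)"
proof (rule fg_cancel_monoid.intro[OF comm_monoid_cancel_Npow], unfold_locales)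
  have "unit_vector k ` {..<k} \<subseteq> carrier (Npow k)"
    by (auto simp: carrier_Npow unit_vector_def)
  moreover have "\<forall>T. submonoid T (Npow k) \<and> unit_vector k ` {..<k} \<subseteq> T \<longrightarrow> T = carrier (Npow k)"
    using submonoid_Npow_eq_carrier by (intro allI impI) (elim conjE)
  ultimately show "\<exists>S. finite S \<and> S \<subseteq> carrier (Npow k) \<and>
      (\<forall>T. submonoid T (Npow k) \<and> S \<subseteq> T \<longrightarrow> T = carrier (Npow k))"
    by (intro exI[where x = "unit_vector k ` {..<k}"] conjI) simp_all
qed

lemma countable_carrier_Npow: "countable (carrier (Npow k))"
proof (rule countableI')
  \<comment> \<open>Extensional functions are determined by their list of values on \<open>{..<k}\<close>.\<close>
  show "inj_on (\<lambda>n. to_nat (map n [0..<k])) (carrier (Npow k))"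
    by (auto intro!: inj_onI extensionalityI[where A = "{..<k}"] simp: carrier_Npow)
qed

section \<open>Pulling back along a homomorphism from \<open>\<nat>\<^sup>k\<close>\<close>

lemma pullback_simps [simp]:
  "(x, n) \<in> mor (pullback k f \<Gamma>) \<longleftrightarrow> x \<in> mor \<Gamma> \<and> n \<in> carrier (Npow k) \<and> deg \<Gamma> x = f n"
  "src (pullback k f \<Gamma>) (x, n) = (src \<Gamma> x, \<one>\<^bsub>Npow k\<^esub>)"
  "rng (pullback k f \<Gamma>) (x, n) = (rng \<Gamma> x, \<one>\<^bsub>Npow k\<^esub>)"
  "cmp (pullback k f \<Gamma>) (x, m) (y, n) = (cmp \<Gamma> x y, m \<otimes>\<^bsub>Npow k\<^esub> n)"
  "deg (pullback k f \<Gamma>) (x, n) = n"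
  by (simp_all add: pullback_def)

text \<open>Cancellation in \<open>P\<close> is what makes a multiplicative map preserve the identity.\<close>

lemma (in comm_monoid_cancel) hom_one_of_cancel:
  assumes "monoid M" "f \<in> hom M G"
  shows "f \<one>\<^bsub>M\<^esub> = \<one>"
proof -
  interpret M: monoid M by fact
  have f1: "f \<one>\<^bsub>M\<^esub> \<in> carrier G"
    using assms(2) by (rule hom_in_carrier) simp
  have "f \<one>\<^bsub>M\<^esub> \<otimes> f \<one>\<^bsub>M\<^esub> = f (\<one>\<^bsub>M\<^esub> \<otimes>\<^bsub>M\<^esub> \<one>\<^bsub>M\<^esub>)"
    using hom_mult[OF assms(2), of "\<one>\<^bsub>M\<^esub>" "\<one>\<^bsub>M\<^esub>"] by simp
  then have "f \<one>\<^bsub>M\<^esub> \<otimes> f \<one>\<^bsub>M\<^esub> = f \<one>\<^bsub>M\<^esub> \<otimes> \<one>"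
    using f1 by simp
  then show ?thesis
    using f1 l_cancel by blast
qed

text \<open>A pair \<open>(v, n)\<close> equal to its own source has \<open>n = 0\<close>; conversely \<open>(v, 0)\<close> lies in the pullback
  because both \<open>deg \<Gamma> v\<close> and \<open>f 0\<close> are the identity of \<open>P\<close>. This is the identification of \<open>v\<close>
  with \<open>(v, 0)\<close>.\<close>

lemma (in P_graph) identities_pullback:
  assumes f: "f \<in> hom (Npow k) P"
  shows "identities (pullback k f \<Gamma>) = identities \<Gamma> \<times> {\<one>\<^bsub>Npow k\<^esub>}"
proof -
  interpret N: fg_cancel_monoid "Npow k" by (rule fg_cancel_monoid_Npow)
  have "f \<one>\<^bsub>Npow k\<^esub> = \<one>"
    using f by (rule hom_one_of_cancel[OF N.monoid_axioms])
  then show ?thesis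
    by (auto simp: identities_def deg_identity)
qed

text \<open>The category axioms hold coordinatewise. Factorisations transfer because the degrees prescribed
  for the factors of \<open>(x, p + q)\<close> already determine their second coordinates, leaving only the
  factorisation of \<open>x\<close> at \<open>f p\<close> and \<open>f q\<close>.\<close>

theorem (in P_graph) k_graph_pullback:
  assumes f: "f \<in> hom (Npow k) P"
  shows "k_graph k (pullback k f \<Gamma>)"
proof -
  interpret N: fg_cancel_monoid "Npow k" by (rule fg_cancel_monoid_Npow)
  note f_mult = hom_mult[OF f] and f_closed = hom_in_carrier[OF f]
  let ?\<Delta> = "pullback k f \<Gamma>"
  note ids = identities_pullback[OF f]
  show ?thesis
  proof (intro P_graph.intro P_graph_axioms.intro small_category.intro)
    show "fg_cancel_monoid (Npow k)" by (rule fg_cancel_monoid_Npow)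
    show "countable (mor ?\<Delta>)"
      by (rule countable_subset[OF _ countable_SIGMA[OF countable_mor countable_carrier_Npow]]) auto
  next
    fix a p q
    assume a: "a \<in> mor ?\<Delta>" and p: "p \<in> carrier (Npow k)" and q: "q \<in> carrier (Npow k)"
      and deg_a: "deg ?\<Delta> a = p \<otimes>\<^bsub>Npow k\<^esub> q"
    obtain x where x: "a = (x, p \<otimes>\<^bsub>Npow k\<^esub> q)" "x \<in> mor \<Gamma>" "deg \<Gamma> x = f p \<otimes> f q"
      using a deg_a f_mult[OF p q] by (cases a) auto
    let ?F = "\<lambda>(y, z). y \<in> mor \<Gamma> \<and> z \<in> mor \<Gamma> \<and> src \<Gamma> y = rng \<Gamma> z \<and>
            deg \<Gamma> y = f p \<and> deg \<Gamma> z = f q \<and> x = cmp \<Gamma> y z"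
    have "\<exists>!w. ?F w"
      using factorisation[OF x(2) f_closed[OF p] f_closed[OF q] x(3)] .
    then obtain w where "?F w" and unique_w: "\<forall>w'. ?F w' \<longrightarrow> w' = w"
      by (rule ex1E)
    then obtain y z where w: "w = (y, z)"
      and yz: "y \<in> mor \<Gamma>" "z \<in> mor \<Gamma>" "src \<Gamma> y = rng \<Gamma> z"
        "deg \<Gamma> y = f p" "deg \<Gamma> z = f q" "x = cmp \<Gamma> y z"
      by (cases w) simp
    have unique: "y' = y \<and> z' = z"
      if "y' \<in> mor \<Gamma>" "z' \<in> mor \<Gamma>" "src \<Gamma> y' = rng \<Gamma> z'"
        "deg \<Gamma> y' = f p" "deg \<Gamma> z' = f q" "x = cmp \<Gamma> y' z'" for y' z'
      using unique_w[rule_format, of "(y', z')"] that w by simp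
    show "\<exists>!(b, c). b \<in> mor ?\<Delta> \<and> c \<in> mor ?\<Delta> \<and> src ?\<Delta> b = rng ?\<Delta> c \<and>
            deg ?\<Delta> b = p \<and> deg ?\<Delta> c = q \<and> a = cmp ?\<Delta> b c"
    proof (rule ex1I[where a = "((y, p), (z, q))"])
      show "case ((y, p), z, q) of (b, c) \<Rightarrow> b \<in> mor ?\<Delta> \<and> c \<in> mor ?\<Delta> \<and>
          src ?\<Delta> b = rng ?\<Delta> c \<and> deg ?\<Delta> b = p \<and> deg ?\<Delta> c = q \<and> a = cmp ?\<Delta> b c"
        using yz p q x(1) by simp
    next
      fix w
      assume "case w of (b, c) \<Rightarrow> b \<in> mor ?\<Delta> \<and> c \<in> mor ?\<Delta> \<and>
          src ?\<Delta> b = rng ?\<Delta> c \<and> deg ?\<Delta> b = p \<and> deg ?\<Delta> c = q \<and> a = cmp ?\<Delta> b c"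
      then obtain y' z' where w: "w = ((y', p), (z', q))"
        and "y' \<in> mor \<Gamma>" "z' \<in> mor \<Gamma>" "src \<Gamma> y' = rng \<Gamma> z'"
          "deg \<Gamma> y' = f p" "deg \<Gamma> z' = f q" "x = cmp \<Gamma> y' z'"
        using x(1) by (cases w) auto
      then show "w = ((y, p), (z, q))"
        using unique by blast
    qed
  qed (auto simp: ids src_identity rng_identity cmp_closed src_cmp rng_cmp cmp_assoc rng_unit
      src_unit deg_cmp f_mult N.m_assoc)
qed

lemma paths_from_pullback:
  assumes "n \<in> carrier (Npow k)"
  shows "paths_from (pullback k f \<Gamma>) (v, \<one>\<^bsub>Npow k\<^esub>) n = (\<lambda>x. (x, n)) ` paths_from \<Gamma> v (f n)"
  using assms by (auto simp: paths_from_def)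

lemma (in P_graph) row_finite_no_sources_pullback:
  assumes "f \<in> hom (Npow k) P" and "row_finite_no_sources P \<Gamma>"
  shows "row_finite_no_sources (Npow k) (pullback k f \<Gamma>)"
  using assms
  by (auto simp: row_finite_no_sources_def identities_pullback paths_from_pullback hom_in_carrier)

section \<open>The quotient map\<close>

lemma quotient_map_hom:
  assumes "subgroup H (Zpow k)"
  shows "quotient_map k H \<in> hom (Npow k) (quotient_monoid k H)"
proof -
  interpret normal H "Zpow k"
    using assms comm_group.subgroup_imp_normal[OF comm_group_Zpow] by blast
  have "quotient_map k H (m \<otimes>\<^bsub>Npow k\<^esub> n) = quotient_map k H m \<otimes>\<^bsub>quotient_monoid k H\<^esub> quotient_map k H n"
    if "m \<in> carrier (Npow k)" "n \<in> carrier (Npow k)" for m n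
  proof -
    have "m \<otimes>\<^bsub>Npow k\<^esub> n = m \<otimes>\<^bsub>Zpow k\<^esub> n"
      by (simp add: Npow_def)
    then show ?thesis
      using rcos_sum[of m n] that carrier_Npow_subset[of k]
      by (simp add: quotient_map_def quotient_monoid_def subset_iff del: mult_product_group)
  qed
  then show ?thesis
    by (auto intro!: homI simp: quotient_monoid_def)
qed

lemma pos_part_in_Npow: "pos_part k h \<in> carrier (Npow k)"
  and neg_part_in_Npow: "neg_part k h \<in> carrier (Npow k)"
  by (auto simp: carrier_Npow pos_part_def neg_part_def)

text \<open>Here \<open>h\<^sub>+ = h + h\<^sub>-\<close>, and adding an element of \<open>H\<close> does not change the coset.\<close>

lemma quotient_map_pos_part_eq_neg_part:
  assumes H: "subgroup H (Zpow k)" and h: "h \<in> H"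
  shows "quotient_map k H (pos_part k h) = quotient_map k H (neg_part k h)"
proof -
  interpret Z: comm_group "Zpow k" by (rule comm_group_Zpow)
  have carriers: "H \<subseteq> carrier (Zpow k)" "h \<in> carrier (Zpow k)" "neg_part k h \<in> carrier (Zpow k)"
    using subgroup.subset[OF H] h carrier_Npow_subset neg_part_in_Npow by blast+
  have "pos_part k h = h \<otimes>\<^bsub>Zpow k\<^esub> neg_part k h"
    by (auto simp: pos_part_def neg_part_def fun_eq_iff)
  then have "H #>\<^bsub>Zpow k\<^esub> pos_part k h = (H #>\<^bsub>Zpow k\<^esub> h) #>\<^bsub>Zpow k\<^esub> neg_part k h"
    using Z.coset_mult_assoc[OF carriers] by metis
  also have "H #>\<^bsub>Zpow k\<^esub> h = H"
    using Z.coset_join2[OF carriers(2) H h] .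
  finally show ?thesis
    by (simp add: quotient_map_def)
qed

section \<open>The pullback along the quotient map\<close>

theorem lemma3p2:
  fixes k :: nat
    and H :: "(nat \<Rightarrow> int) set"
    and \<Gamma> :: "('m, (nat \<Rightarrow> int) set) graded_precat"
  assumes "subgroup H (Zpow k)"
    and "P_graph (quotient_monoid k H) \<Gamma>"
    and "row_finite_no_sources (quotient_monoid k H) \<Gamma>"
  shows "k_graph k (pullback k (quotient_map k H) \<Gamma>)
    \<and> row_finite_no_sources (Npow k) (pullback k (quotient_map k H) \<Gamma>)
    \<and> (\<forall>h\<in>H. \<forall>x\<in>mor \<Gamma>. deg \<Gamma> x = quotient_map k H (pos_part k h) \<longrightarrow>
          (x, pos_part k h) \<in> mor (pullback k (quotient_map k H) \<Gamma>)
        \<and> (x, neg_part k h) \<in> mor (pullback k (quotient_map k H) \<Gamma>))"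
proof -
  interpret P_graph "quotient_monoid k H" \<Gamma> by fact
  have hom: "quotient_map k H \<in> hom (Npow k) (quotient_monoid k H)"
    using assms(1) by (rule quotient_map_hom)
  show ?thesis
    using k_graph_pullback[OF hom] row_finite_no_sources_pullback[OF hom assms(3)]
      quotient_map_pos_part_eq_neg_part[OF assms(1)]
    by (auto simp: pos_part_in_Npow neg_part_in_Npow)
qed

end
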